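(* The tableau calculus of HPL is complete for the class of product frames: for every HPL formula $\varphi$, if $\models \varphi$, then $\vdash \varphi$.
   Context: **Language.** Fix a countable set $\mathbf{Prop}$ of propositional variables and two disjoint countably infinite sets $\mathbf{Nom}_1$, $\mathbf{Nom}_2$ of nominals, disjoint from $\mathbf{Prop}$; $\mathbf{Nom}=\mathbf{Nom}_1\cup\mathbf{Nom}_2$. Letters $i,j,k$ range over $\mathbf{Nom}_1$ and $a,b,c$ over $\mathbf{Nom}_2$. HPL formulas: $\varphi ::= p \mid i \mid a \mid \neg\varphi \mid \varphi\land\varphi \mid \diamondsuit_1\varphi \mid \diamondsuit_2\varphi \mid @_i\varphi \mid @_a\varphi$ with $p\in\mathbf{Prop}$. **Semantics.** A Kripke frame is $(W,R)$ with $W$ a non-empty countable set and $R\subseteq W\times W$. Given Kripke frames $(W_1,R_1)$, $(W_2,R_2)$, the product frame is $(W,R_h,R_v)$ with $W=W_1\times W_2$; $(x,y)R_h(x',y')$ iff $xR_1x'$ and $y=y'$; $(x,y)R_v(x',y')$ iff $x=x'$ and $yR_2y'$. A product model $\mathfrak M=(\mathfrak F,V)$ is a product frame $\mathfrak F$ with $V:\mathbf{Prop}\cup\mathbf{Nom}\to\mathcal P(W)$ such that $V(i)=\{x\}\times W_2$ for some $x\in W_1$ (this $x$ is denoted $i^V$) and $V(a)=W_1\times\{y\}$ for some $y\in W_2$ (denoted $a^V$). Satisfaction: $\mathfrak M,(x,y)\models p$ iff $(x,y)\in V(p)$; $\models i$ iff $x=i^V$; $\models a$ iff $y=a^V$;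 $\neg,\land$ as usual; $\models\diamondsuit_1\varphi$ (resp. $\diamondsuit_2\varphi$) iff $\varphi$ holds at some $R_h$-successor (resp. $R_v$-successor) of $(x,y)$; $\mathfrak M,(x,y)\models @_i\varphi$ iff $\mathfrak M,(i^V,y)\models\varphi$; $\mathfrak M,(x,y)\models @_a\varphi$ iff $\mathfrak M,(x,a^V)\models\varphi$. $\models\varphi$ means $\varphi$ holds at every point of every product model. **Tableau.** A tableau is a well-founded tree (each node is reached from the root in finitely many steps; branches may be infinite) constructed as follows. Start with a root formula of the form $@_i@_a\neg\varphi$, where $i,a$ do not occur in $\varphi$. Extend each branch by applying the rules below to all nodes as often as possible; no formula can be added to a branch any more if every new formula generated by applying an arbitrary rule already exists in the branch, or if the branch is closed. A branch is a maximal path; $\varphi\in\Theta$ means $\varphi$ occurs in the branch $\Theta$. Rules (premises / formulas added to the branch; "$\mid$" means the branch splits): - $[\neg\neg]$: $@_i@_a\neg\neg\varphi\ /\ @_i@_a\varphi$. - $[\land]$: $@_i@_a(\varphi\land\psi)\ /\ @_i@_a\varphi,\ @_i@_a\psi$. - $[\neg\land]$: $@_i@_a\neg(\varphi\land\psi)\ /\ @_i@_a\neg\varphi\mid @_i@_a\neg\psi$. - $[\diamondsuit_1]$: $@_i@_a\diamondsuit_1\varphi\ /\ @_i\diamondsuit_1 j,\ @_j@_a\varphi$, where $j\in\mathbf{Nom}_1$ does not occur in the branch; applied only once per formula. - $[\diamondsuit_2]$: $@_i@_a\diamondsuit_2\varphi\ /\ @_a\diamondsuit_2 b,\ @_i@_b\varphi$,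 where $b\in\mathbf{Nom}_2$ does not occur in the branch; applied only once per formula. - $[\neg\diamondsuit_1]$: $@_i@_a\neg\diamondsuit_1\varphi,\ @_i\diamondsuit_1 j\ /\ @_j@_a\neg\varphi$. - $[\neg\diamondsuit_2]$: $@_i@_a\neg\diamondsuit_2\varphi,\ @_a\diamondsuit_2 b\ /\ @_i@_b\neg\varphi$. - $[@_1]$: $@_i@_a@_j\varphi\ /\ @_j@_a\varphi$. $[@_2]$: $@_i@_a@_b\varphi\ /\ @_i@_b\varphi$. - $[\neg@_1]$: $@_i@_a\neg@_j\varphi\ /\ @_j@_a\neg\varphi$. $[\neg@_2]$: $@_i@_a\neg@_b\varphi\ /\ @_i@_b\neg\varphi$. - $[Red_1]$: $@_i@_as\ /\ @_is$. $[Red_2]$: $@_i@_at\ /\ @_at$. - $[\neg_1]$: $@_i\neg j\ /\ @_jj$. $[\neg_2]$: $@_a\neg b\ /\ @_bb$. - $[Id_1]$: $@_i@_a\varphi,\ @_ij\ /\ @_j@_a\varphi$. $[Id_2]$: $@_i@_a\varphi,\ @_ab\ /\ @_i@_b\varphi$. - $[Id'_1]$: $@_is,\ @_ij\ /\ @_js$. $[Id'_2]$: $@_at,\ @_ab\ /\ @_bt$. In $Red_1,Id'_1$: $s=k$ or $\neg k$ with $k\in\mathbf{Nom}_1$; in $Red_2,Id'_2$: $t=c$ or $\neg c$ with $c\in\mathbf{Nom}_2$. A branch $\Theta$ is closed if for some $\varphi,i,a$: $@_i@_a\varphi,@_i@_a\neg\varphi\in\Theta$, or $@_i\varphi,@_i\neg\varphi\in\Theta$,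 or $@_a\varphi,@_a\neg\varphi\in\Theta$; otherwise open. A tableau is closed if all its branches are closed. **Provability.** $\vdash\varphi$ iff there is a closed tableau whose root formula is $@_i@_a\neg\varphi$, with $i\in\mathbf{Nom}_1$, $a\in\mathbf{Nom}_2$ not occurring in $\varphi$. *)

theory Defs
  imports
    Complex_Main
    "HOL-Library.Countable_Set"
    "HOL-Library.Infinite_Typeclass"
    "HOL-Library.Sublist"
begin

section \<open>Language\<close>

text \<open>
  The sets Prop, Nom1 and Nom2 are the type parameters \<open>'p\<close>, \<open>'n\<close>, \<open>'m\<close>, which makes them
  disjoint. Their cardinalities are sort constraints, imposed where they matter.
\<close>

datatype ('p, 'n, 'm) atom = Prop 'p | Nom1 'n | Nom2 'm

datatype (props: 'p, nom1s: 'n, nom2s: 'm) fm =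
    Atom "('p, 'n, 'm) atom"
  | Neg "('p, 'n, 'm) fm"
  | And "('p, 'n, 'm) fm" "('p, 'n, 'm) fm"
  | Dia1 "('p, 'n, 'm) fm"
  | Dia2 "('p, 'n, 'm) fm"
  | At1 'n "('p, 'n, 'm) fm"
  | At2 'm "('p, 'n, 'm) fm"

abbreviation nm1 :: "'n \<Rightarrow> ('p, 'n, 'm) fm" where "nm1 i \<equiv> Atom (Nom1 i)"
abbreviation nm2 :: "'m \<Rightarrow> ('p, 'n, 'm) fm" where "nm2 a \<equiv> Atom (Nom2 a)"
abbreviation at12 :: "'n \<Rightarrow> 'm \<Rightarrow> ('p, 'n, 'm) fm \<Rightarrow> ('p, 'n, 'm) fm"
  where "at12 i a \<phi> \<equiv> At1 i (At2 a \<phi>)"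


section \<open>Semantics\<close>

record 'w kripke_frame =
  worlds :: "'w set"
  acc :: "('w \<times> 'w) set"

definition kripke_frame :: "'w kripke_frame \<Rightarrow> bool" where
  "kripke_frame F \<longleftrightarrow>
     worlds F \<noteq> {} \<and> countable (worlds F) \<and> acc F \<subseteq> worlds F \<times> worlds F"

definition pworlds :: "'w kripke_frame \<Rightarrow> 'v kripke_frame \<Rightarrow> ('w \<times> 'v) set" where
  "pworlds F G = worlds F \<times> worlds G"

definition hrel :: "'w kripke_frame \<Rightarrow> 'v kripke_frame \<Rightarrow> (('w \<times> 'v) \<times> ('w \<times> 'v)) set" where
  "hrel F G = {((x, y), (x', y')). (x, y) \<in> pworlds F G \<and> (x', y') \<in> pworlds F G
                                   \<and> (x, x') \<in> acc F \<and> y = y'}"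

definition vrel :: "'w kripke_frame \<Rightarrow> 'v kripke_frame \<Rightarrow> (('w \<times> 'v) \<times> ('w \<times> 'v)) set" where
  "vrel F G = {((x, y), (x', y')). (x, y) \<in> pworlds F G \<and> (x', y') \<in> pworlds F G
                                   \<and> x = x' \<and> (y, y') \<in> acc G}"

record ('w, 'v, 'p, 'n, 'm) model =
  frame1 :: "'w kripke_frame"
  frame2 :: "'v kripke_frame"
  val :: "('p, 'n, 'm) atom \<Rightarrow> ('w \<times> 'v) set"

definition product_model :: "('w, 'v, 'p, 'n, 'm) model \<Rightarrow> bool" where
  "product_model M \<longleftrightarrow>
     kripke_frame (frame1 M) \<and> kripke_frame (frame2 M) \<and>
     (\<forall>A. val M A \<subseteq> pworlds (frame1 M) (frame2 M)) \<and>
     (\<forall>i. \<exists>x\<in>worlds (frame1 M). val M (Nom1 i) = {x} \<times> worlds (frame2 M)) \<and>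
     (\<forall>a. \<exists>y\<in>worlds (frame2 M). val M (Nom2 a) = worlds (frame1 M) \<times> {y})"

definition den1 :: "('w, 'v, 'p, 'n, 'm) model \<Rightarrow> 'n \<Rightarrow> 'w" where
  "den1 M i = (THE x. x \<in> worlds (frame1 M) \<and> val M (Nom1 i) = {x} \<times> worlds (frame2 M))"

definition den2 :: "('w, 'v, 'p, 'n, 'm) model \<Rightarrow> 'm \<Rightarrow> 'v" where
  "den2 M a = (THE y. y \<in> worlds (frame2 M) \<and> val M (Nom2 a) = worlds (frame1 M) \<times> {y})"

fun sat :: "('w, 'v, 'p, 'n, 'm) model \<Rightarrow> 'w \<times> 'v \<Rightarrow> ('p, 'n, 'm) fm \<Rightarrow> bool" where
  "sat M (x, y) (Atom (Prop p)) \<longleftrightarrow> (x, y) \<in> val M (Prop p)"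
| "sat M (x, y) (Atom (Nom1 i)) \<longleftrightarrow> x = den1 M i"
| "sat M (x, y) (Atom (Nom2 a)) \<longleftrightarrow> y = den2 M a"
| "sat M (x, y) (Neg \<phi>) \<longleftrightarrow> \<not> sat M (x, y) \<phi>"
| "sat M (x, y) (And \<phi> \<psi>) \<longleftrightarrow> sat M (x, y) \<phi> \<and> sat M (x, y) \<psi>"
| "sat M (x, y) (Dia1 \<phi>) \<longleftrightarrow> (\<exists>z. ((x, y), z) \<in> hrel (frame1 M) (frame2 M) \<and> sat M z \<phi>)"
| "sat M (x, y) (Dia2 \<phi>) \<longleftrightarrow> (\<exists>z. ((x, y), z) \<in> vrel (frame1 M) (frame2 M) \<and> sat M z \<phi>)"
| "sat M (x, y) (At1 i \<phi>) \<longleftrightarrow> sat M (den1 M i, y) \<phi>"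
| "sat M (x, y) (At2 a \<phi>) \<longleftrightarrow> sat M (x, den2 M a) \<phi>"

definition true_in :: "('w, 'v, 'p, 'n, 'm) model \<Rightarrow> ('p, 'n, 'm) fm \<Rightarrow> bool" where
  "true_in M \<phi> \<longleftrightarrow> (\<forall>w\<in>pworlds (frame1 M) (frame2 M). sat M w \<phi>)"

text \<open>
  A definition cannot quantify over all types of worlds. Frames are countable, so it suffices to
  let them range over all frames whose worlds are natural numbers; \<open>valid_true_in\<close> below shows
  that this covers the countable frames over arbitrary types.
\<close>

definition valid :: "('p, 'n, 'm) fm \<Rightarrow> bool" where
  "valid \<phi> \<longleftrightarrow> (\<forall>M :: (nat, nat, 'p, 'n, 'm) model. product_model M \<longrightarrow> true_in M \<phi>)"

lemma den1_eq:
  assumes "product_model M" "x \<in> worlds (frame1 M)" "val M (Nom1 i) = {x} \<times> worlds (frame2 M)"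
  shows "den1 M i = x"
  unfolding den1_def
proof (rule the_equality)
  fix z assume "z \<in> worlds (frame1 M) \<and> val M (Nom1 i) = {z} \<times> worlds (frame2 M)"
  moreover have "worlds (frame2 M) \<noteq> {}"
    using assms(1) by (simp add: product_model_def kripke_frame_def)
  ultimately show "z = x" using assms(3) by blast
qed (use assms in auto)

lemma den2_eq:
  assumes "product_model M" "y \<in> worlds (frame2 M)" "val M (Nom2 a) = worlds (frame1 M) \<times> {y}"
  shows "den2 M a = y"
  unfolding den2_def
proof (rule the_equality)
  fix z assume "z \<in> worlds (frame2 M) \<and> val M (Nom2 a) = worlds (frame1 M) \<times> {z}"
  moreover have "worlds (frame1 M) \<noteq> {}"
    using assms(1) by (simp add: product_model_def kripke_frame_def)
  ultimately show "z = y" using assms(3) by blast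
qed (use assms in auto)

lemma den1_val:
  assumes "product_model M"
  shows "den1 M i \<in> worlds (frame1 M)" "val M (Nom1 i) = {den1 M i} \<times> worlds (frame2 M)"
proof -
  obtain x where "x \<in> worlds (frame1 M)" "val M (Nom1 i) = {x} \<times> worlds (frame2 M)"
    using assms unfolding product_model_def by blast
  with den1_eq[OF assms this]
  show "den1 M i \<in> worlds (frame1 M)" "val M (Nom1 i) = {den1 M i} \<times> worlds (frame2 M)" by auto
qed

lemma den2_val:
  assumes "product_model M"
  shows "den2 M a \<in> worlds (frame2 M)" "val M (Nom2 a) = worlds (frame1 M) \<times> {den2 M a}"
proof -
  obtain y where "y \<in> worlds (frame2 M)" "val M (Nom2 a) = worlds (frame1 M) \<times> {y}"
    using assms unfolding product_model_def by blast
  with den2_eq[OF assms this]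
  show "den2 M a \<in> worlds (frame2 M)" "val M (Nom2 a) = worlds (frame1 M) \<times> {den2 M a}" by auto
qed

lemma sat_Dia1:
  assumes "product_model M" "x \<in> worlds (frame1 M)" "y \<in> worlds (frame2 M)"
  shows "sat M (x, y) (Dia1 \<phi>) \<longleftrightarrow> (\<exists>x'. (x, x') \<in> acc (frame1 M) \<and> sat M (x', y) \<phi>)"
proof -
  have "x' \<in> worlds (frame1 M)" if "(x, x') \<in> acc (frame1 M)" for x'
    using assms(1) that by (auto simp: product_model_def kripke_frame_def)
  with assms(2,3) show ?thesis by (auto simp: hrel_def pworlds_def)
qed

lemma sat_Dia2:
  assumes "product_model M" "x \<in> worlds (frame1 M)" "y \<in> worlds (frame2 M)"
  shows "sat M (x, y) (Dia2 \<phi>) \<longleftrightarrow> (\<exists>y'. (y, y') \<in> acc (frame2 M) \<and> sat M (x, y') \<phi>)"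
proof -
  have "y' \<in> worlds (frame2 M)" if "(y, y') \<in> acc (frame2 M)" for y'
    using assms(1) that by (auto simp: product_model_def kripke_frame_def)
  with assms(2,3) show ?thesis by (auto simp: vrel_def pworlds_def)
qed

lemma valid_true_in:
  fixes M :: "('w, 'v, 'p, 'n, 'm) model"
  assumes valid: "valid \<phi>" and M: "product_model M"
  shows "true_in M \<phi>"
proof -
  define X where "X = worlds (frame1 M)"
  define Y where "Y = worlds (frame2 M)"
  define f where "f = to_nat_on X"
  define g where "g = to_nat_on Y"
  have cX: "countable X" and cY: "countable Y" and neX: "X \<noteq> {}" and neY: "Y \<noteq> {}"
    and aX: "acc (frame1 M) \<subseteq> X \<times> X" and aY: "acc (frame2 M) \<subseteq> Y \<times> Y"
    using M unfolding product_model_def kripke_frame_def X_def Y_def by auto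
  have vM: "val M A \<subseteq> X \<times> Y" for A
    using M unfolding product_model_def pworlds_def X_def Y_def by auto
  have f: "f x = f x' \<longleftrightarrow> x = x'" if "x \<in> X" "x' \<in> X" for x x'
    using that cX unfolding f_def by simp
  have g: "g y = g y' \<longleftrightarrow> y = y'" if "y \<in> Y" "y' \<in> Y" for y y'
    using that cY unfolding g_def by simp
  define N :: "(nat, nat, 'p, 'n, 'm) model" where
    "N = \<lparr>frame1 = \<lparr>worlds = f ` X, acc = map_prod f f ` acc (frame1 M)\<rparr>,
          frame2 = \<lparr>worlds = g ` Y, acc = map_prod g g ` acc (frame2 M)\<rparr>,
          val = (\<lambda>A. map_prod f g ` val M A)\<rparr>"
  have d1: "den1 M i \<in> X" "val M (Nom1 i) = {den1 M i} \<times> Y" for i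
    using den1_val[OF M] by (simp_all add: X_def Y_def)
  have d2: "den2 M a \<in> Y" "val M (Nom2 a) = X \<times> {den2 M a}" for a
    using den2_val[OF M] by (simp_all add: X_def Y_def)
  have v1: "val N (Nom1 i) = {f (den1 M i)} \<times> worlds (frame2 N)" for i
    unfolding N_def using d1(2)[of i] by (auto simp: image_iff)
  have v2: "val N (Nom2 a) = worlds (frame1 N) \<times> {g (den2 M a)}" for a
    unfolding N_def using d2(2)[of a] by (auto simp: image_iff)
  have w1: "f (den1 M i) \<in> worlds (frame1 N)" for i using d1 by (simp add: N_def)
  have w2: "g (den2 M a) \<in> worlds (frame2 N)" for a using d2 by (simp add: N_def)
  have fr: "kripke_frame (frame1 N)" "kripke_frame (frame2 N)"
    unfolding kripke_frame_def N_def using neX neY aX aY by auto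
  have "val N A \<subseteq> pworlds (frame1 N) (frame2 N)" for A
    unfolding N_def pworlds_def using vM[of A] by auto
  with fr v1 v2 w1 w2 have N: "product_model N"
    unfolding product_model_def by blast
  have e1: "den1 N i = f (den1 M i)" for i using den1_eq[OF N w1 v1] .
  have e2: "den2 N a = g (den2 M a)" for a using den2_eq[OF N w2 v2] .
  have a1: "(f x, u) \<in> acc (frame1 N) \<longleftrightarrow> (\<exists>x'. u = f x' \<and> (x, x') \<in> acc (frame1 M))"
    if x: "x \<in> X" for x u
  proof
    assume "(f x, u) \<in> acc (frame1 N)"
    then obtain z x' where z: "(z, x') \<in> acc (frame1 M)" "f x = f z" "u = f x'"
      by (auto simp: N_def)
    with x aX f have "z = x" by blast
    with z show "\<exists>x'. u = f x' \<and> (x, x') \<in> acc (frame1 M)" by blast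
  next
    assume "\<exists>x'. u = f x' \<and> (x, x') \<in> acc (frame1 M)"
    then show "(f x, u) \<in> acc (frame1 N)" by (force simp: N_def)
  qed
  have a2: "(g y, u) \<in> acc (frame2 N) \<longleftrightarrow> (\<exists>y'. u = g y' \<and> (y, y') \<in> acc (frame2 M))"
    if y: "y \<in> Y" for y u
  proof
    assume "(g y, u) \<in> acc (frame2 N)"
    then obtain z y' where z: "(z, y') \<in> acc (frame2 M)" "g y = g z" "u = g y'"
      by (auto simp: N_def)
    with y aY g have "z = y" by blast
    with z show "\<exists>y'. u = g y' \<and> (y, y') \<in> acc (frame2 M)" by blast
  next
    assume "\<exists>y'. u = g y' \<and> (y, y') \<in> acc (frame2 M)"
    then show "(g y, u) \<in> acc (frame2 N)" by (force simp: N_def)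
  qed
  have wN: "worlds (frame1 N) = f ` X" "worlds (frame2 N) = g ` Y" by (simp_all add: N_def)
  have "sat N (f x, g y) \<psi> \<longleftrightarrow> sat M (x, y) \<psi>" if "x \<in> X" "y \<in> Y" for x y and \<psi> :: "('p, 'n, 'm) fm"
    using that
  proof (induction \<psi> arbitrary: x y)
    case (Atom A)
    show ?case
    proof (cases A)
      case (Prop p)
      have "(f x, g y) \<in> map_prod f g ` val M A \<longleftrightarrow> (x, y) \<in> val M A"
      proof
        assume "(f x, g y) \<in> map_prod f g ` val M A"
        then obtain x' y' where *: "(x', y') \<in> val M A" "f x = f x'" "g y = g y'" by auto
        with Atom vM[of A] f g have "x' = x" "y' = y" by blast+
        with * show "(x, y) \<in> val M A" by simp
      qed force
      then show ?thesis by (simp add: N_def Prop)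
    next
      case (Nom1 i)
      then show ?thesis using Atom f d1(1) by (simp add: e1)
    next
      case (Nom2 a)
      then show ?thesis using Atom g d2(1) by (simp add: e2)
    qed
  next
    case (Dia1 \<psi>)
    have "sat N (f x, g y) (Dia1 \<psi>) \<longleftrightarrow> (\<exists>u. (f x, u) \<in> acc (frame1 N) \<and> sat N (u, g y) \<psi>)"
      by (rule sat_Dia1[OF N]) (use Dia1.prems in \<open>simp_all add: wN\<close>)
    also have "\<dots> \<longleftrightarrow> (\<exists>x'. (x, x') \<in> acc (frame1 M) \<and> sat N (f x', g y) \<psi>)"
      unfolding a1[OF Dia1.prems(1)] by blast
    also have "\<dots> \<longleftrightarrow> (\<exists>x'. (x, x') \<in> acc (frame1 M) \<and> sat M (x', y) \<psi>)"
      using Dia1.IH[OF _ Dia1.prems(2)] aX by blast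
    also have "\<dots> \<longleftrightarrow> sat M (x, y) (Dia1 \<psi>)"
      by (rule sat_Dia1[OF M, symmetric]) (use Dia1.prems in \<open>simp_all add: X_def Y_def\<close>)
    finally show ?case .
  next
    case (Dia2 \<psi>)
    have "sat N (f x, g y) (Dia2 \<psi>) \<longleftrightarrow> (\<exists>u. (g y, u) \<in> acc (frame2 N) \<and> sat N (f x, u) \<psi>)"
      by (rule sat_Dia2[OF N]) (use Dia2.prems in \<open>simp_all add: wN\<close>)
    also have "\<dots> \<longleftrightarrow> (\<exists>y'. (y, y') \<in> acc (frame2 M) \<and> sat N (f x, g y') \<psi>)"
      unfolding a2[OF Dia2.prems(2)] by blast
    also have "\<dots> \<longleftrightarrow> (\<exists>y'. (y, y') \<in> acc (frame2 M) \<and> sat M (x, y') \<psi>)"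
      using Dia2.IH[OF Dia2.prems(1)] aY by blast
    also have "\<dots> \<longleftrightarrow> sat M (x, y) (Dia2 \<psi>)"
      by (rule sat_Dia2[OF M, symmetric]) (use Dia2.prems in \<open>simp_all add: X_def Y_def\<close>)
    finally show ?case .
  next
    case (At1 i \<psi>)
    then show ?case using d1(1) by (simp add: e1)
  next
    case (At2 a \<psi>)
    then show ?case using d2(1) by (simp add: e2)
  qed simp_all
  moreover have "true_in N \<phi>" using valid N unfolding valid_def by blast
  ultimately show ?thesis
    unfolding true_in_def by (auto simp: pworlds_def wN X_def[symmetric] Y_def[symmetric])
qed


section \<open>Tableau rules\<close>

definition lit1 :: "('p, 'n, 'm) fm set" where
  "lit1 = {s. \<exists>k. s = nm1 k \<or> s = Neg (nm1 k)}"

definition lit2 :: "('p, 'n, 'm) fm set" where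
  "lit2 = {t. \<exists>c. t = nm2 c \<or> t = Neg (nm2 c)}"

text \<open>
  \<open>rule P Cs\<close> is an instance of a rule other than the two diamond rules: \<open>P\<close> is the set of
  premises, and the branch splits into one branch for each element of \<open>Cs\<close>, which is the set of
  formulas added there.
\<close>

inductive rule :: "('p, 'n, 'm) fm set \<Rightarrow> ('p, 'n, 'm) fm set list \<Rightarrow> bool" where
  NegNeg: "rule {at12 i a (Neg (Neg \<phi>))} [{at12 i a \<phi>}]"
| Conj: "rule {at12 i a (And \<phi> \<psi>)} [{at12 i a \<phi>, at12 i a \<psi>}]"
| NegConj: "rule {at12 i a (Neg (And \<phi> \<psi>))} [{at12 i a (Neg \<phi>)}, {at12 i a (Neg \<psi>)}]"
| NegDia1: "rule {at12 i a (Neg (Dia1 \<phi>)), At1 i (Dia1 (nm1 j))} [{at12 j a (Neg \<phi>)}]"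
| NegDia2: "rule {at12 i a (Neg (Dia2 \<phi>)), At2 a (Dia2 (nm2 b))} [{at12 i b (Neg \<phi>)}]"
| SatOp1: "rule {at12 i a (At1 j \<phi>)} [{at12 j a \<phi>}]"
| SatOp2: "rule {at12 i a (At2 b \<phi>)} [{at12 i b \<phi>}]"
| NegSatOp1: "rule {at12 i a (Neg (At1 j \<phi>))} [{at12 j a (Neg \<phi>)}]"
| NegSatOp2: "rule {at12 i a (Neg (At2 b \<phi>))} [{at12 i b (Neg \<phi>)}]"
| Red1: "s \<in> lit1 \<Longrightarrow> rule {at12 i a s} [{At1 i s}]"
| Red2: "t \<in> lit2 \<Longrightarrow> rule {at12 i a t} [{At2 a t}]"
| NegNom1: "rule {At1 i (Neg (nm1 j))} [{At1 j (nm1 j)}]"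
| NegNom2: "rule {At2 a (Neg (nm2 b))} [{At2 b (nm2 b)}]"
| Id1: "rule {at12 i a \<phi>, At1 i (nm1 j)} [{at12 j a \<phi>}]"
| Id2: "rule {at12 i a \<phi>, At2 a (nm2 b)} [{at12 i b \<phi>}]"
| Id1': "s \<in> lit1 \<Longrightarrow> rule {At1 i s, At1 i (nm1 j)} [{At1 j s}]"
| Id2': "t \<in> lit2 \<Longrightarrow> rule {At2 a t, At2 a (nm2 b)} [{At2 b t}]"

text \<open>
  \<open>dia_rule \<Theta> \<chi> C\<close>: on a branch with formulas \<open>\<Theta>\<close>, a diamond rule applied to \<open>\<chi>\<close> adds \<open>C\<close>.
\<close>

inductive dia_rule ::
  "('p, 'n, 'm) fm set \<Rightarrow> ('p, 'n, 'm) fm \<Rightarrow> ('p, 'n, 'm) fm set \<Rightarrow> bool" for \<Theta> where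
  Dia1: "j \<notin> (\<Union>\<psi>\<in>\<Theta>. nom1s \<psi>) \<Longrightarrow>
    dia_rule \<Theta> (at12 i a (Dia1 \<phi>)) {At1 i (Dia1 (nm1 j)), at12 j a \<phi>}"
| Dia2: "b \<notin> (\<Union>\<psi>\<in>\<Theta>. nom2s \<psi>) \<Longrightarrow>
    dia_rule \<Theta> (at12 i a (Dia2 \<phi>)) {At2 a (Dia2 (nm2 b)), at12 i b \<phi>}"

definition dia_premises :: "('p, 'n, 'm) fm set" where
  "dia_premises = {\<chi>. \<exists>i a \<phi>. \<chi> = at12 i a (Dia1 \<phi>) \<or> \<chi> = at12 i a (Dia2 \<phi>)}"

definition closed_fms :: "('p, 'n, 'm) fm set \<Rightarrow> bool" where
  "closed_fms \<Theta> \<longleftrightarrow>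
     (\<exists>\<phi> i a. at12 i a \<phi> \<in> \<Theta> \<and> at12 i a (Neg \<phi>) \<in> \<Theta>) \<or>
     (\<exists>\<phi> i. At1 i \<phi> \<in> \<Theta> \<and> At1 i (Neg \<phi>) \<in> \<Theta>) \<or>
     (\<exists>\<phi> a. At2 a \<phi> \<in> \<Theta> \<and> At2 a (Neg \<phi>) \<in> \<Theta>)"


section \<open>Tableaux\<close>

text \<open>
  The nodes of a tree are addresses: \<open>[]\<close> is the root and \<open>u @ [k]\<close> the \<open>k\<close>-th child of \<open>u\<close>, so each
  node is reached from the root in finitely many steps while branches may be infinite. A node is
  labelled with the formulas that one rule application adds to its branch. The component
  \<open>dia_at\<close> records the formula to which a diamond rule is applied at a node, and is \<open>None\<close> at
  leaves and where another rule is applied; it expresses that a diamond rule is applied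
  only once per formula.
\<close>

record ('p, 'n, 'm) tree =
  nodes :: "nat list set"
  label :: "nat list \<Rightarrow> ('p, 'n, 'm) fm set"
  dia_at :: "nat list \<Rightarrow> ('p, 'n, 'm) fm option"

definition is_tree :: "('p, 'n, 'm) tree \<Rightarrow> bool" where
  "is_tree T \<longleftrightarrow> [] \<in> nodes T \<and> (\<forall>u v. v \<in> nodes T \<and> prefix u v \<longrightarrow> u \<in> nodes T)"

definition path_fms :: "('p, 'n, 'm) tree \<Rightarrow> nat list \<Rightarrow> ('p, 'n, 'm) fm set" where
  "path_fms T u = (\<Union>v\<in>{v. prefix v u}. label T v)"

definition has_children ::
  "('p, 'n, 'm) tree \<Rightarrow> nat list \<Rightarrow> ('p, 'n, 'm) fm set list \<Rightarrow> bool" where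
  "has_children T u Cs \<longleftrightarrow>
     {k. u @ [k] \<in> nodes T} = {..<length Cs} \<and> (\<forall>k<length Cs. label T (u @ [k]) = Cs ! k)"

definition leaf_node :: "('p, 'n, 'm) tree \<Rightarrow> nat list \<Rightarrow> bool" where
  "leaf_node T u \<longleftrightarrow> has_children T u [] \<and> dia_at T u = None"

text \<open>
  A rule is only applied if it adds a new formula on each of the resulting branches. This
  needs no mention for the diamond rules, because of the fresh nominal.
\<close>

definition rule_node :: "('p, 'n, 'm) tree \<Rightarrow> nat list \<Rightarrow> bool" where
  "rule_node T u \<longleftrightarrow> dia_at T u = None \<and>
     (\<exists>P Cs. rule P Cs \<and> P \<subseteq> path_fms T u \<and> (\<forall>C\<in>set Cs. \<not> C \<subseteq> path_fms T u) \<and>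
        has_children T u Cs)"

definition dia_node :: "('p, 'n, 'm) tree \<Rightarrow> nat list \<Rightarrow> bool" where
  "dia_node T u \<longleftrightarrow>
     (\<exists>\<chi> C. dia_at T u = Some \<chi> \<and> \<chi> \<in> path_fms T u \<and> dia_rule (path_fms T u) \<chi> C \<and>
        (\<forall>v. strict_prefix v u \<longrightarrow> dia_at T v \<noteq> Some \<chi>) \<and> has_children T u [C])"

definition branch :: "('p, 'n, 'm) tree \<Rightarrow> nat list set \<Rightarrow> bool" where
  "branch T \<beta> \<longleftrightarrow> pred_on.maxchain (nodes T) strict_prefix \<beta>"

definition branch_fms :: "('p, 'n, 'm) tree \<Rightarrow> nat list set \<Rightarrow> ('p, 'n, 'm) fm set" where
  "branch_fms T \<beta> = (\<Union>u\<in>\<beta>. label T u)"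

definition closed_branch :: "('p, 'n, 'm) tree \<Rightarrow> nat list set \<Rightarrow> bool" where
  "closed_branch T \<beta> \<longleftrightarrow> closed_fms (branch_fms T \<beta>)"

text \<open>
  No rule can add anything to a saturated branch. A splitting rule has nothing to add as soon as
  the formulas of one of its alternatives are present.
\<close>

definition saturated :: "('p, 'n, 'm) tree \<Rightarrow> nat list set \<Rightarrow> bool" where
  "saturated T \<beta> \<longleftrightarrow>
     (\<forall>P Cs. rule P Cs \<and> P \<subseteq> branch_fms T \<beta> \<longrightarrow> (\<exists>C\<in>set Cs. C \<subseteq> branch_fms T \<beta>)) \<and>
     (\<forall>\<chi>\<in>branch_fms T \<beta> \<inter> dia_premises. \<exists>u\<in>\<beta>. dia_at T u = Some \<chi>)"

definition tableau :: "('p, 'n, 'm) fm \<Rightarrow> ('p, 'n, 'm) tree \<Rightarrow> bool" where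
  "tableau \<rho> T \<longleftrightarrow> is_tree T \<and> label T [] = {\<rho>} \<and>
     (\<forall>u\<in>nodes T. leaf_node T u \<or> (\<not> closed_fms (path_fms T u) \<and> (rule_node T u \<or> dia_node T u))) \<and>
     (\<forall>\<beta>. branch T \<beta> \<longrightarrow> closed_branch T \<beta> \<or> saturated T \<beta>)"

definition closed_tableau :: "('p, 'n, 'm) tree \<Rightarrow> bool" where
  "closed_tableau T \<longleftrightarrow> (\<forall>\<beta>. branch T \<beta> \<longrightarrow> closed_branch T \<beta>)"

definition provable :: "('p, 'n, 'm) fm \<Rightarrow> bool" where
  "provable \<phi> \<longleftrightarrow> (\<exists>i a T. i \<notin> nom1s \<phi> \<and> a \<notin> nom2s \<phi> \<and>
     tableau (at12 i a (Neg \<phi>)) T \<and> closed_tableau T)"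

end

theory Submission
  imports Defs
begin

text \<open>
  Completeness is proved by contraposition of the usual kind: a systematic tableau for
  \<open>@\<^sub>i @\<^sub>a \<not>\<phi>\<close> is built all of whose open branches are saturated, and a saturated open branch
  \<open>\<Theta>\<close> yields a countable product model in which \<open>\<phi>\<close> fails at the point named by \<open>i\<close> and \<open>a\<close>. So if
  \<open>\<phi>\<close> is valid, the systematic tableau has no open branch.

  The delicate point of the model construction is equality of nominals. The relation
  ``\<open>@\<^sub>i j \<in> \<Theta>\<close>'' need be neither reflexive nor symmetric nor transitive, because the
  calculus has no rule for these properties; but \<open>Id\<^sub>1'\<close> makes it Euclidean. In a Euclidean
  relation all successors of \<open>i\<close> lie in a single cluster, so \<open>i\<close> can be interpreted by a chosen
  member of that cluster, or by \<open>i\<close> itself if there is no successor (lemmas \<open>rep_step\<close> and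
  \<open>rep_eq_step\<close>). The rules \<open>Id\<^sub>1\<close> and \<open>Id\<^sub>2\<close> carry every formula \<open>@\<^sub>i @\<^sub>a \<psi>\<close> along the relation, hence
  to the representatives. They do not carry \<open>@\<^sub>i \<diamondsuit>\<^sub>1 j\<close>, and therefore the accessibility relation
  of the model only uses those formulas \<open>@\<^sub>u \<diamondsuit>\<^sub>1 j\<close> in which \<open>u\<close> is itself a representative; the
  diamond rule, applied to the formulas that have been carried to \<open>u\<close>, provides enough of them.
  This gives the truth lemma \<open>truth\<close>.

  The systematic tableau enumerates all rule applications once and for all, and at each node carries
  out the first one that is possible there. A rule application that has been carried out is never
  possible again further down, so it can postpone another one at most once. Hence no
  possible application is postponed forever (lemma \<open>fairness\<close>), which is what saturation needs.
\<close>


section \<open>Representatives in a Euclidean relation\<close>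

definition euclidean :: "('a \<Rightarrow> 'a \<Rightarrow> bool) \<Rightarrow> bool" where
  "euclidean r \<longleftrightarrow> (\<forall>x y z. r x y \<longrightarrow> r x z \<longrightarrow> r y z)"

text \<open>
  The successors of the successors of \<open>x\<close> form the whole cluster to which \<open>x\<close> leads, whereas
  the successors of \<open>x\<close> alone may be only a part of it. Choosing from the whole cluster makes
  the choice agree for all points that lead to it.
\<close>

definition rep :: "('a \<Rightarrow> 'a \<Rightarrow> bool) \<Rightarrow> 'a \<Rightarrow> 'a" where
  "rep r x = (if \<exists>y. r x y then SOME z. \<exists>y. r x y \<and> r y z else x)"

lemma rep_reachable:
  assumes "euclidean r" "r x y"
  shows "r y (rep r x)"
proof -
  have "r y y" using assms unfolding euclidean_def by blast
  with assms(2) have "\<exists>z y. r x y \<and> r y z" by blast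
  then have "\<exists>y. r x y \<and> r y (SOME z. \<exists>y. r x y \<and> r y z)" by (rule someI_ex)
  with assms(2) have "\<exists>y. r x y \<and> r y (rep r x)" unfolding rep_def by auto
  with assms show ?thesis unfolding euclidean_def by blast
qed

lemma rep_invariant:
  assumes "euclidean r" "P x" "\<And>x y. P x \<Longrightarrow> r x y \<Longrightarrow> P y"
  shows "P (rep r x)"
proof (cases "\<exists>y. r x y")
  case True
  then show ?thesis using assms rep_reachable[OF assms(1)] by blast
next
  case False
  then show ?thesis using assms(2) by (simp add: rep_def)
qed

lemma rep_step:
  assumes "euclidean r" "r x y"
  shows "rep r x = rep r y"
proof -
  have E: "r b c" if "r a b" "r a c" for a b c using assms(1) that unfolding euclidean_def by blast
  have y: "r y y" using E[OF assms(2) assms(2)] .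
  have "(\<exists>w. r x w \<and> r w z) \<longleftrightarrow> (\<exists>w. r y w \<and> r w z)" for z
  proof
    assume "\<exists>w. r x w \<and> r w z"
    then obtain w where w: "r x w" "r w z" by blast
    have "r w y" using E[OF w(1) assms(2)] .
    then have "r y z" using w(2) by (rule E)
    with y show "\<exists>w. r y w \<and> r w z" by blast
  next
    assume "\<exists>w. r y w \<and> r w z"
    then obtain w where w: "r y w" "r w z" by blast
    have "r w y" using E[OF w(1) y] .
    then have "r y z" using w(2) by (rule E)
    with assms(2) show "\<exists>w. r x w \<and> r w z" by blast
  qed
  moreover have "\<exists>w. r x w" "\<exists>w. r y w" using assms(2) y by blast+
  ultimately show ?thesis unfolding rep_def by simp
qed

text \<open>
  Reflexivity at \<open>y\<close> puts \<open>y\<close> into the cluster of its representative, and then \<open>x\<close>, having the same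
  representative, must lead into that cluster, although perhaps not to \<open>y\<close> directly.
\<close>

lemma rep_eq_step:
  assumes r: "euclidean r" and eq: "rep r x = rep r y" and refl: "r y y"
  shows "\<exists>z. r x z \<and> r z y"
proof -
  have E: "r b c" if "r a b" "r a c" for a b c using r that unfolding euclidean_def by blast
  have y: "r (rep r y) y" using E[OF rep_reachable[OF r refl] refl] .
  obtain z where z: "r x z"
  proof (cases "\<exists>z. r x z")
    case False
    then have "rep r x = x" by (simp add: rep_def)
    with eq y False show ?thesis by simp
  qed (use that in blast)
  have "r (rep r x) z" using E[OF rep_reachable[OF r z] E[OF z z]] .
  then have "r (rep r y) z" by (simp add: eq)
  then have "r z y" using y by (rule E)
  with z show ?thesis by blast
qed


section \<open>The model of a saturated open set\<close>

locale saturated_open =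
  fixes \<Theta> :: "('p :: countable, 'n :: countable, 'm :: countable) fm set"
  assumes rules: "rule P Cs \<Longrightarrow> P \<subseteq> \<Theta> \<Longrightarrow> \<exists>C\<in>set Cs. C \<subseteq> \<Theta>"
    and dia1: "at12 i a (Dia1 \<phi>) \<in> \<Theta> \<Longrightarrow> \<exists>j. At1 i (Dia1 (nm1 j)) \<in> \<Theta> \<and> at12 j a \<phi> \<in> \<Theta>"
    and dia2: "at12 i a (Dia2 \<phi>) \<in> \<Theta> \<Longrightarrow> \<exists>b. At2 a (Dia2 (nm2 b)) \<in> \<Theta> \<and> at12 i b \<phi> \<in> \<Theta>"
    and not_closed: "\<not> closed_fms \<Theta>"
begin

definition eq1 :: "'n \<Rightarrow> 'n \<Rightarrow> bool" where "eq1 i j \<longleftrightarrow> At1 i (nm1 j) \<in> \<Theta>"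
definition eq2 :: "'m \<Rightarrow> 'm \<Rightarrow> bool" where "eq2 a b \<longleftrightarrow> At2 a (nm2 b) \<in> \<Theta>"

abbreviation rep1 :: "'n \<Rightarrow> 'n" where "rep1 \<equiv> rep eq1"
abbreviation rep2 :: "'m \<Rightarrow> 'm" where "rep2 \<equiv> rep eq2"

lemma transfer_lit1: "s \<in> lit1 \<Longrightarrow> At1 i s \<in> \<Theta> \<Longrightarrow> eq1 i j \<Longrightarrow> At1 j s \<in> \<Theta>"
  using rules[OF rule.Id1'[of s i j]] by (simp add: eq1_def)

lemma transfer_lit2: "t \<in> lit2 \<Longrightarrow> At2 a t \<in> \<Theta> \<Longrightarrow> eq2 a b \<Longrightarrow> At2 b t \<in> \<Theta>"
  using rules[OF rule.Id2'[of t a b]] by (simp add: eq2_def)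

lemma euclidean_eq1: "euclidean eq1"
  unfolding euclidean_def
proof (intro allI impI)
  fix i j k
  assume "eq1 i j" "eq1 i k"
  then show "eq1 j k" using transfer_lit1[of "nm1 k" i j] by (simp add: eq1_def lit1_def)
qed

lemma euclidean_eq2: "euclidean eq2"
  unfolding euclidean_def
proof (intro allI impI)
  fix a b c
  assume "eq2 a b" "eq2 a c"
  then show "eq2 b c" using transfer_lit2[of "nm2 c" a b] by (simp add: eq2_def lit2_def)
qed

lemma at_rep1: "at12 i a \<phi> \<in> \<Theta> \<Longrightarrow> at12 (rep1 i) a \<phi> \<in> \<Theta>"
proof (erule rep_invariant[OF euclidean_eq1])
  show "at12 y a \<phi> \<in> \<Theta>" if "at12 x a \<phi> \<in> \<Theta>" "eq1 x y" for x y
    using rules[OF rule.Id1[of x a \<phi> y]] that by (simp add: eq1_def)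
qed

lemma at_rep2: "at12 i a \<phi> \<in> \<Theta> \<Longrightarrow> at12 i (rep2 a) \<phi> \<in> \<Theta>"
proof (erule rep_invariant[OF euclidean_eq2])
  show "at12 i y \<phi> \<in> \<Theta>" if "at12 i x \<phi> \<in> \<Theta>" "eq2 x y" for x y
    using rules[OF rule.Id2[of i x \<phi> y]] that by (simp add: eq2_def)
qed

lemma pos_nom1: "at12 i a (nm1 j) \<in> \<Theta> \<Longrightarrow> rep1 i = rep1 j"
  using rules[OF rule.Red1[of "nm1 j" i a]] rep_step[OF euclidean_eq1, of i j]
  by (simp add: lit1_def eq1_def)

lemma pos_nom2: "at12 i a (nm2 b) \<in> \<Theta> \<Longrightarrow> rep2 a = rep2 b"
  using rules[OF rule.Red2[of "nm2 b" i a]] rep_step[OF euclidean_eq2, of a b]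
  by (simp add: lit2_def eq2_def)

text \<open>
  The rule \<open>\<not>\<^sub>1\<close> makes \<open>j\<close> a member of its cluster. Otherwise \<open>i\<close> and \<open>j\<close> could both lead to a
  cluster that does not contain \<open>j\<close>, and \<open>\<not>j\<close>, when carried around that cluster, would meet no
  formula \<open>@\<^sub>k j\<close> to contradict it.
\<close>

lemma neg_nom1:
  assumes "at12 i a (Neg (nm1 j)) \<in> \<Theta>"
  shows "rep1 i \<noteq> rep1 j"
proof
  assume eq: "rep1 i = rep1 j"
  have lit: "Neg (nm1 j) \<in> lit1" by (simp add: lit1_def)
  have neg: "At1 i (Neg (nm1 j)) \<in> \<Theta>" using assms rules[OF rule.Red1[OF lit, of i a]] by simp
  then have "eq1 j j" using rules[OF rule.NegNom1[of i j]] by (simp add: eq1_def)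
  then obtain k where k: "eq1 i k" "eq1 k j" using rep_eq_step[OF euclidean_eq1 eq] by blast
  then have "At1 k (Neg (nm1 j)) \<in> \<Theta>" "At1 k (nm1 j) \<in> \<Theta>"
    using transfer_lit1[OF lit neg, of k] by (simp_all add: eq1_def)
  with not_closed show False unfolding closed_fms_def by blast
qed

lemma neg_nom2:
  assumes "at12 i a (Neg (nm2 b)) \<in> \<Theta>"
  shows "rep2 a \<noteq> rep2 b"
proof
  assume eq: "rep2 a = rep2 b"
  have lit: "Neg (nm2 b) \<in> lit2" by (simp add: lit2_def)
  have neg: "At2 a (Neg (nm2 b)) \<in> \<Theta>" using assms rules[OF rule.Red2[OF lit, of i a]] by simp
  then have "eq2 b b" using rules[OF rule.NegNom2[of a b]] by (simp add: eq2_def)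
  then obtain c where c: "eq2 a c" "eq2 c b" using rep_eq_step[OF euclidean_eq2 eq] by blast
  then have "At2 c (Neg (nm2 b)) \<in> \<Theta>" "At2 c (nm2 b) \<in> \<Theta>"
    using transfer_lit2[OF lit neg, of c] by (simp_all add: eq2_def)
  with not_closed show False unfolding closed_fms_def by blast
qed

definition canonical :: "('n, 'm, 'p, 'n, 'm) model" where
  "canonical =
     \<lparr>frame1 = \<lparr>worlds = range rep1,
                acc = {(u, rep1 j) | u j. u \<in> range rep1 \<and> At1 u (Dia1 (nm1 j)) \<in> \<Theta>}\<rparr>,
      frame2 = \<lparr>worlds = range rep2,
                acc = {(u, rep2 b) | u b. u \<in> range rep2 \<and> At2 u (Dia2 (nm2 b)) \<in> \<Theta>}\<rparr>,
      val = (\<lambda>A. case A of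
               Prop p \<Rightarrow> {(rep1 i, rep2 a) | i a. at12 i a (Atom (Prop p)) \<in> \<Theta>}
             | Nom1 i \<Rightarrow> {rep1 i} \<times> range rep2
             | Nom2 a \<Rightarrow> range rep1 \<times> {rep2 a})\<rparr>"

lemma product_model_canonical: "product_model canonical"
  unfolding product_model_def kripke_frame_def canonical_def pworlds_def
  by (auto split: atom.splits)

lemma den1_canonical: "den1 canonical i = rep1 i"
  by (rule den1_eq[OF product_model_canonical]) (simp_all add: canonical_def)

lemma den2_canonical: "den2 canonical a = rep2 a"
  by (rule den2_eq[OF product_model_canonical]) (simp_all add: canonical_def)

lemma sat_canonical_Dia1:
  "sat canonical (rep1 i, rep2 a) (Dia1 \<phi>) \<longleftrightarrow>
     (\<exists>j. At1 (rep1 i) (Dia1 (nm1 j)) \<in> \<Theta> \<and> sat canonical (rep1 j, rep2 a) \<phi>)"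
  by (subst sat_Dia1[OF product_model_canonical]) (auto simp: canonical_def)

lemma sat_canonical_Dia2:
  "sat canonical (rep1 i, rep2 a) (Dia2 \<phi>) \<longleftrightarrow>
     (\<exists>b. At2 (rep2 a) (Dia2 (nm2 b)) \<in> \<Theta> \<and> sat canonical (rep1 i, rep2 b) \<phi>)"
  by (subst sat_Dia2[OF product_model_canonical]) (auto simp: canonical_def)

text \<open>
  In the cases of propositional variables and diamonds the formula has to be carried to the
  representatives first. For the former this brings the positive and the negated occurrence to the
  same pair of nominals, and for the latter it makes the formula meet the formulas
  \<open>@\<^sub>u \<diamondsuit>\<^sub>1 j\<close> that define the accessibility relation.
\<close>

lemma truth:
  "(at12 i a \<phi> \<in> \<Theta> \<longrightarrow> sat canonical (rep1 i, rep2 a) \<phi>) \<and>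
   (at12 i a (Neg \<phi>) \<in> \<Theta> \<longrightarrow> \<not> sat canonical (rep1 i, rep2 a) \<phi>)"
proof (induction \<phi> arbitrary: i a)
  case (Atom A)
  show ?case
  proof (cases A)
    case (Prop p)
    have False
      if neg: "at12 i a (Neg (Atom (Prop p))) \<in> \<Theta>" and pos: "at12 j b (Atom (Prop p)) \<in> \<Theta>"
        and eq: "rep1 i = rep1 j" "rep2 a = rep2 b" for j b
    proof -
      have "at12 (rep1 i) (rep2 a) (Neg (Atom (Prop p))) \<in> \<Theta>"
        using at_rep1[OF at_rep2[OF neg]] .
      moreover have "at12 (rep1 i) (rep2 a) (Atom (Prop p)) \<in> \<Theta>"
        using at_rep1[OF at_rep2[OF pos]] eq by simp
      ultimately show False using not_closed unfolding closed_fms_def by blast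
    qed
    then show ?thesis unfolding Prop by (auto simp: canonical_def)
  next
    case (Nom1 j)
    then show ?thesis using pos_nom1 neg_nom1 by (auto simp: den1_canonical)
  next
    case (Nom2 b)
    then show ?thesis using pos_nom2 neg_nom2 by (auto simp: den2_canonical)
  qed
next
  case (Neg \<phi>)
  then show ?case using rules[OF rule.NegNeg[of i a \<phi>]] by auto
next
  case (And \<phi> \<psi>)
  have "at12 i a \<phi> \<in> \<Theta> \<and> at12 i a \<psi> \<in> \<Theta>" if "at12 i a (And \<phi> \<psi>) \<in> \<Theta>"
    using rules[OF rule.Conj[of i a \<phi> \<psi>]] that by simp
  moreover have "at12 i a (Neg \<phi>) \<in> \<Theta> \<or> at12 i a (Neg \<psi>) \<in> \<Theta>" if "at12 i a (Neg (And \<phi> \<psi>)) \<in> \<Theta>"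
    using rules[OF rule.NegConj[of i a \<phi> \<psi>]] that by simp
  ultimately show ?case using And.IH by auto
next
  case (Dia1 \<phi>)
  have "\<exists>j. At1 (rep1 i) (Dia1 (nm1 j)) \<in> \<Theta> \<and> at12 j a \<phi> \<in> \<Theta>" if "at12 i a (Dia1 \<phi>) \<in> \<Theta>"
    using dia1[OF at_rep1[OF that]] .
  moreover have "at12 j a (Neg \<phi>) \<in> \<Theta>"
    if "at12 i a (Neg (Dia1 \<phi>)) \<in> \<Theta>" "At1 (rep1 i) (Dia1 (nm1 j)) \<in> \<Theta>" for j
    using rules[OF rule.NegDia1[of "rep1 i" a \<phi> j]] at_rep1[OF that(1)] that(2) by simp
  ultimately show ?case using Dia1.IH unfolding sat_canonical_Dia1 by blast
next
  case (Dia2 \<phi>)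
  have "\<exists>b. At2 (rep2 a) (Dia2 (nm2 b)) \<in> \<Theta> \<and> at12 i b \<phi> \<in> \<Theta>" if "at12 i a (Dia2 \<phi>) \<in> \<Theta>"
    using dia2[OF at_rep2[OF that]] .
  moreover have "at12 i b (Neg \<phi>) \<in> \<Theta>"
    if "at12 i a (Neg (Dia2 \<phi>)) \<in> \<Theta>" "At2 (rep2 a) (Dia2 (nm2 b)) \<in> \<Theta>" for b
    using rules[OF rule.NegDia2[of i "rep2 a" \<phi> b]] at_rep2[OF that(1)] that(2) by simp
  ultimately show ?case using Dia2.IH unfolding sat_canonical_Dia2 by blast
next
  case (At1 j \<phi>)
  then show ?case
    using rules[OF rule.SatOp1[of i a j \<phi>]] rules[OF rule.NegSatOp1[of i a j \<phi>]]
    by (simp add: den1_canonical)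
next
  case (At2 b \<phi>)
  then show ?case
    using rules[OF rule.SatOp2[of i a b \<phi>]] rules[OF rule.NegSatOp2[of i a b \<phi>]]
    by (simp add: den2_canonical)
qed

lemma refutes:
  assumes "at12 i a (Neg \<phi>) \<in> \<Theta>"
  shows "\<not> valid \<phi>"
proof
  assume "valid \<phi>"
  then have "true_in canonical \<phi>" using product_model_canonical by (rule valid_true_in)
  then have "sat canonical (rep1 i, rep2 a) \<phi>"
    unfolding true_in_def by (auto simp: pworlds_def canonical_def)
  with assms truth show False by blast
qed

end


section \<open>Pending rule applications\<close>

text \<open>
  A task is a rule application to be scheduled: \<open>Inl (P, Cs)\<close> is an instance of a rule without
  freshness condition, \<open>Inr \<chi>\<close> is the application of a diamond rule to \<open>\<chi>\<close>. The fresh nominal is not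
  part of the task, because it can be chosen only when the branch so far is known.
\<close>

type_synonym ('p, 'n, 'm) task =
  "(('p, 'n, 'm) fm set \<times> ('p, 'n, 'm) fm set list) + ('p, 'n, 'm) fm"

instance atom :: (countable, countable, countable) countable by countable_datatype
instance fm :: (countable, countable, countable) countable by countable_datatype

text \<open>The set \<open>S\<close> holds the formulas on the branch, \<open>U\<close> those already used by a diamond rule.\<close>

fun pending ::
  "('p, 'n, 'm) fm set \<Rightarrow> ('p, 'n, 'm) fm set \<Rightarrow> ('p, 'n, 'm) task \<Rightarrow> bool" where
  "pending S U (Inl (P, Cs)) \<longleftrightarrow> rule P Cs \<and> P \<subseteq> S \<and> (\<forall>C\<in>set Cs. \<not> C \<subseteq> S)"
| "pending S U (Inr \<chi>) \<longleftrightarrow> \<chi> \<in> S \<and> \<chi> \<in> dia_premises \<and> \<chi> \<notin> U"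

fun outcomes :: "('p, 'n, 'm) fm set \<Rightarrow> ('p, 'n, 'm) task \<Rightarrow> ('p, 'n, 'm) fm set list" where
  "outcomes S (Inl (P, Cs)) = Cs"
| "outcomes S (Inr \<chi>) = [SOME C. dia_rule S \<chi> C]"

fun dia_of :: "('p, 'n, 'm) task \<Rightarrow> ('p, 'n, 'm) fm option" where
  "dia_of (Inl _) = None"
| "dia_of (Inr \<chi>) = Some \<chi>"

definition tasks :: "('p, 'n, 'm) task set" where
  "tasks = {t. \<exists>S U. pending S U t}"

definition code :: "('p, 'n, 'm) task \<Rightarrow> nat" where
  "code = to_nat_on tasks"

definition next_task ::
  "('p, 'n, 'm) fm set \<Rightarrow> ('p, 'n, 'm) fm set \<Rightarrow> ('p, 'n, 'm) task option" where
  "next_task S U =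
     (if closed_fms S \<or> (\<forall>t. \<not> pending S U t) then None
      else Some (arg_min code (pending S U)))"

lemma rule_finite:
  assumes "rule P Cs"
  shows "finite P" "Cs \<noteq> []" "\<forall>C\<in>set Cs. finite C"
  using assms by (induction rule: rule.induct) auto

lemma dia_rule_finite: "dia_rule S \<chi> C \<Longrightarrow> finite C"
  by (induction rule: dia_rule.induct) auto

lemma countable_tasks:
  "countable (tasks :: ('p :: countable, 'n :: countable, 'm :: countable) task set)"
proof -
  let ?F = "{C :: ('p, 'n, 'm) fm set. finite C}"
  have "countable ?F" using countable_Collect_finite by simp
  then have "countable (Inl ` (?F \<times> lists ?F) \<union> range Inr :: ('p, 'n, 'm) task set)"
    by (intro countable_Un countable_image countable_SIGMA countable_lists) simp_all
  moreover have "tasks \<subseteq> Inl ` (?F \<times> lists ?F) \<union> range Inr"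
  proof
    fix t :: "('p, 'n, 'm) task"
    assume "t \<in> tasks"
    then obtain S U where "pending S U t" by (auto simp: tasks_def)
    then show "t \<in> Inl ` (?F \<times> lists ?F) \<union> range Inr"
      by (cases "(S, U, t)" rule: pending.cases) (auto dest: rule_finite simp: lists_eq_set)
  qed
  ultimately show ?thesis by (rule countable_subset[rotated])
qed

lemma code_inj:
  fixes t t' :: "('p :: countable, 'n :: countable, 'm :: countable) task"
  assumes "pending S U t" "pending S' U' t'" "code t = code t'"
  shows "t = t'"
proof -
  have "t \<in> tasks" "t' \<in> tasks" using assms(1,2) unfolding tasks_def by blast+
  from to_nat_on_inj[OF countable_tasks this] assms(3) show ?thesis unfolding code_def by simp
qed

lemma next_task_SomeD:
  assumes "next_task S U = Some t"
  shows "\<not> closed_fms S" "pending S U t" "pending S U t' \<Longrightarrow> code t \<le> code t'"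
proof -
  from assms obtain t0 where "pending S U t0" "\<not> closed_fms S" "t = arg_min code (pending S U)"
    unfolding next_task_def by (auto split: if_splits)
  with arg_min_nat_lemma[of "pending S U" t0 code]
  show "\<not> closed_fms S" "pending S U t" "pending S U t' \<Longrightarrow> code t \<le> code t'" by blast+
qed

lemma outcomes_nonempty: "pending S U t \<Longrightarrow> outcomes S t \<noteq> []"
  by (cases "(S, U, t)" rule: pending.cases) (auto dest: rule_finite)

lemma finite_noms: "finite (nom1s \<phi>)" "finite (nom2s \<phi>)"
proof (induction \<phi>)
  case (Atom A)
  { case 1 show ?case by (cases A) auto }
  { case 2 show ?case by (cases A) auto }
qed auto

lemma ex_dia_rule:
  fixes S :: "('p, 'n :: infinite, 'm :: infinite) fm set"
  assumes "finite S" "\<chi> \<in> dia_premises"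
  shows "\<exists>C. dia_rule S \<chi> C"
proof -
  have "finite (\<Union>\<psi>\<in>S. nom1s \<psi>)" "finite (\<Union>\<psi>\<in>S. nom2s \<psi>)"
    using assms(1) finite_noms by auto
  then obtain j b where "j \<notin> (\<Union>\<psi>\<in>S. nom1s \<psi>)" "b \<notin> (\<Union>\<psi>\<in>S. nom2s \<psi>)"
    using ex_new_if_finite[OF infinite_UNIV] by meson
  with assms(2) show ?thesis
    unfolding dia_premises_def by (auto intro: dia_rule.intros)
qed

lemma outcomes_dia:
  fixes S :: "('p, 'n :: infinite, 'm :: infinite) fm set"
  assumes "finite S" "pending S U (Inr \<chi>)"
  obtains C where "outcomes S (Inr \<chi>) = [C]" "dia_rule S \<chi> C"
  using someI_ex[OF ex_dia_rule, of S \<chi>] assms by simp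

lemma outcomes_finite:
  fixes S :: "('p, 'n :: infinite, 'm :: infinite) fm set"
  assumes "finite S" "pending S U t" "C \<in> set (outcomes S t)"
  shows "finite C"
proof (cases t)
  case (Inl z)
  with assms show ?thesis by (cases z) (auto dest: rule_finite(3))
next
  case (Inr \<chi>)
  with assms show ?thesis by (auto elim!: outcomes_dia dest: dia_rule_finite)
qed


section \<open>The systematic tableau\<close>

text \<open>
  The state of a node consists of its label, the formulas on the path to it, and the
  formulas to which a diamond rule has been applied above it. A step to the \<open>k\<close>-th child yields
  \<open>None\<close> if there is no such child.
\<close>

type_synonym ('p, 'n, 'm) state =
  "('p, 'n, 'm) fm set \<times> ('p, 'n, 'm) fm set \<times> ('p, 'n, 'm) fm set"

definition child_state ::
  "('p, 'n, 'm) state option \<Rightarrow> nat \<Rightarrow> ('p, 'n, 'm) state option" where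
  "child_state s k = (case s of None \<Rightarrow> None | Some (L, S, U) \<Rightarrow>
     (case next_task S U of None \<Rightarrow> None | Some t \<Rightarrow>
        (if k < length (outcomes S t)
         then Some (outcomes S t ! k, S \<union> outcomes S t ! k, U \<union> set_option (dia_of t))
         else None)))"

definition state :: "('p, 'n, 'm) fm \<Rightarrow> nat list \<Rightarrow> ('p, 'n, 'm) state option" where
  "state \<rho> u = foldl child_state (Some ({\<rho>}, {\<rho>}, {})) u"

definition systematic :: "('p, 'n, 'm) fm \<Rightarrow> ('p, 'n, 'm) tree" where
  "systematic \<rho> =
     \<lparr>nodes = {u. state \<rho> u \<noteq> None},
      label = (\<lambda>u. fst (the (state \<rho> u))),
      dia_at = (\<lambda>u. case state \<rho> u of None \<Rightarrow> None | Some (L, S, U) \<Rightarrow>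
                      Option.bind (next_task S U) dia_of)\<rparr>"

definition used :: "('p, 'n, 'm) tree \<Rightarrow> nat list \<Rightarrow> ('p, 'n, 'm) fm set" where
  "used T u = {\<chi>. \<exists>v. strict_prefix v u \<and> dia_at T v = Some \<chi>}"

abbreviation task_at :: "('p, 'n, 'm) tree \<Rightarrow> nat list \<Rightarrow> ('p, 'n, 'm) task option" where
  "task_at T u \<equiv> next_task (path_fms T u) (used T u)"

abbreviation pending_at :: "('p, 'n, 'm) tree \<Rightarrow> nat list \<Rightarrow> ('p, 'n, 'm) task \<Rightarrow> bool" where
  "pending_at T u \<equiv> pending (path_fms T u) (used T u)"

lemma path_fms_Nil [simp]: "path_fms T [] = label T []"
  by (simp add: path_fms_def)

lemma path_fms_snoc [simp]: "path_fms T (u @ [k]) = path_fms T u \<union> label T (u @ [k])"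
  by (auto simp: path_fms_def)

lemma path_fms_mono: "prefix u v \<Longrightarrow> path_fms T u \<subseteq> path_fms T v"
  unfolding path_fms_def using prefix_order.trans[of _ u v] by blast

lemma used_Nil [simp]: "used T [] = {}"
  by (simp add: used_def)

lemma used_snoc [simp]: "used T (u @ [k]) = used T u \<union> set_option (dia_at T u)"
proof -
  have "strict_prefix v (u @ [k]) \<longleftrightarrow> strict_prefix v u \<or> v = u" for v
    unfolding strict_prefix_def by (auto dest: prefix_length_le)
  then show ?thesis unfolding used_def by auto
qed

lemma used_mono: "prefix u v \<Longrightarrow> used T u \<subseteq> used T v"
  unfolding used_def using prefix_order.less_le_trans[of _ u v] by blast

lemma state_Nil: "state \<rho> [] = Some ({\<rho>}, {\<rho>}, {})"
  by (simp add: state_def)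

lemma state_snoc: "state \<rho> (u @ [k]) = child_state (state \<rho> u) k"
  by (simp add: state_def)

lemma state_eq:
  "u \<in> nodes (systematic \<rho>) \<Longrightarrow>
   state \<rho> u = Some (label (systematic \<rho>) u, path_fms (systematic \<rho>) u, used (systematic \<rho>) u)"
proof (induction u rule: rev_induct)
  case Nil
  show ?case by (simp add: state_Nil systematic_def)
next
  case (snoc k u)
  from snoc.prems have "child_state (state \<rho> u) k \<noteq> None"
    by (simp add: systematic_def state_snoc)
  then obtain L S U t where s: "state \<rho> u = Some (L, S, U)" and t: "next_task S U = Some t"
    and k: "k < length (outcomes S t)"
    unfolding child_state_def by (auto split: option.splits if_splits)
  then have c: "state \<rho> (u @ [k]) =
              Some (outcomes S t ! k, S \<union> outcomes S t ! k, U \<union> set_option (dia_of t))"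
    by (simp add: state_snoc child_state_def)
  from s have "u \<in> nodes (systematic \<rho>)" by (simp add: systematic_def)
  from snoc.IH[OF this] s have "S = path_fms (systematic \<rho>) u" "U = used (systematic \<rho>) u"
    by auto
  moreover have "dia_at (systematic \<rho>) u = dia_of t" using s t by (simp add: systematic_def)
  moreover have "label (systematic \<rho>) (u @ [k]) = outcomes S t ! k"
    using c by (simp add: systematic_def)
  ultimately show ?case using c by simp
qed

text \<open>
  A systematic tableau is determined by its root, the children of its nodes, their labels and the
  formulas to which diamond rules are applied. All four can be described in terms of paths alone,
  which makes the states dispensable in later arguments.
\<close>

lemma systematic_Nil: "[] \<in> nodes (systematic \<rho>)" "label (systematic \<rho>) [] = {\<rho>}"
  by (simp_all add: systematic_def state_Nil)

lemma systematic_snoc: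
  "u @ [k] \<in> nodes (systematic \<rho>) \<longleftrightarrow>
     u \<in> nodes (systematic \<rho>) \<and>
     (\<exists>t. task_at (systematic \<rho>) u = Some t \<and>
          k < length (outcomes (path_fms (systematic \<rho>) u) t))"
proof (cases "u \<in> nodes (systematic \<rho>)")
  case True
  have "u @ [k] \<in> nodes (systematic \<rho>) \<longleftrightarrow> child_state (state \<rho> u) k \<noteq> None"
    by (simp add: systematic_def state_snoc)
  with True show ?thesis
    unfolding state_eq[OF True] child_state_def by (auto split: option.splits)
next
  case False
  then have "state \<rho> u = None" by (cases "state \<rho> u") (auto simp: systematic_def)
  then show ?thesis using False by (simp add: systematic_def state_snoc child_state_def)
qed

lemma systematic_label:
  assumes "u @ [k] \<in> nodes (systematic \<rho>)" "task_at (systematic \<rho>) u = Some t"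
  shows "label (systematic \<rho>) (u @ [k]) = outcomes (path_fms (systematic \<rho>) u) t ! k"
proof -
  from assms systematic_snoc[of u k \<rho>] have u: "u \<in> nodes (systematic \<rho>)"
    and k: "k < length (outcomes (path_fms (systematic \<rho>) u) t)" by auto
  have "state \<rho> (u @ [k]) = child_state (state \<rho> u) k" by (rule state_snoc)
  then have "fst (the (state \<rho> (u @ [k]))) = outcomes (path_fms (systematic \<rho>) u) t ! k"
    unfolding state_eq[OF u] using assms(2) k by (simp add: child_state_def)
  then show ?thesis by (simp add: systematic_def)
qed

lemma systematic_dia_at:
  assumes "u \<in> nodes (systematic \<rho>)"
  shows "dia_at (systematic \<rho>) u = Option.bind (task_at (systematic \<rho>) u) dia_of"
proof -
  have "dia_at (systematic \<rho>) u = (case state \<rho> u of None \<Rightarrow> None | Some (L, S, U) \<Rightarrow>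
          Option.bind (next_task S U) dia_of)"
    by (simp add: systematic_def)
  then show ?thesis unfolding state_eq[OF assms] by simp
qed

lemma is_tree_systematic: "is_tree (systematic \<rho>)"
proof -
  have "v \<in> nodes (systematic \<rho>) \<longrightarrow> prefix u v \<longrightarrow> u \<in> nodes (systematic \<rho>)" for u v
    by (induction v rule: rev_induct) (auto simp: systematic_snoc)
  then show ?thesis unfolding is_tree_def using systematic_Nil by blast
qed

lemma finite_path_fms:
  fixes \<rho> :: "('p, 'n :: infinite, 'm :: infinite) fm"
  shows "u \<in> nodes (systematic \<rho>) \<Longrightarrow> finite (path_fms (systematic \<rho>) u)"
proof (induction u rule: rev_induct)
  case Nil
  show ?case by (simp add: systematic_Nil)
next
  case (snoc k u)
  let ?S = "path_fms (systematic \<rho>) u"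
  from snoc.prems obtain t where u: "u \<in> nodes (systematic \<rho>)"
    and t: "task_at (systematic \<rho>) u = Some t" and k: "k < length (outcomes ?S t)"
    unfolding systematic_snoc by blast
  then have "finite (outcomes ?S t ! k)"
    using outcomes_finite[OF snoc.IH next_task_SomeD(2)] nth_mem by blast
  then show ?case using snoc.IH[OF u] systematic_label[OF snoc.prems t] by simp
qed

lemma node_systematic:
  fixes \<rho> :: "('p, 'n :: infinite, 'm :: infinite) fm"
  assumes u: "u \<in> nodes (systematic \<rho>)"
  defines "T \<equiv> systematic \<rho>"
  shows "leaf_node T u \<or> (\<not> closed_fms (path_fms T u) \<and> (rule_node T u \<or> dia_node T u))"
proof (cases "task_at T u")
  case None
  then have "leaf_node T u"
    using u systematic_dia_at[OF u] systematic_snoc[of u _ \<rho>]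
    by (auto simp: leaf_node_def has_children_def T_def)
  then show ?thesis ..
next
  case (Some t)
  note t = next_task_SomeD[OF Some]
  have ch: "has_children T u (outcomes (path_fms T u) t)"
    unfolding has_children_def using u Some systematic_snoc[of u _ \<rho>] systematic_label[of u _ \<rho> t]
    by (auto simp: T_def)
  have d: "dia_at T u = dia_of t" using systematic_dia_at[OF u] Some by (simp add: T_def)
  have "rule_node T u \<or> dia_node T u"
  proof (cases t)
    case (Inl z)
    then obtain P Cs where "t = Inl (P, Cs)" by (cases z) auto
    then have "rule_node T u" unfolding rule_node_def using t(2) ch d by auto
    then show ?thesis ..
  next
    case (Inr \<chi>)
    then obtain C where C: "outcomes (path_fms T u) t = [C]" "dia_rule (path_fms T u) \<chi> C"
      using outcomes_dia[OF finite_path_fms[OF u]] t(2) unfolding T_def by metis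
    have "\<chi> \<in> path_fms T u" "\<forall>v. strict_prefix v u \<longrightarrow> dia_at T v \<noteq> Some \<chi>"
      using t(2) Inr by (auto simp: used_def)
    then have "dia_node T u" unfolding dia_node_def using C ch d Inr by auto
    then show ?thesis ..
  qed
  with t(1) show ?thesis by blast
qed


section \<open>Branches\<close>

lemma branchD:
  assumes "branch T \<beta>"
  shows branch_nodes: "u \<in> \<beta> \<Longrightarrow> u \<in> nodes T"
    and branch_comparable: "u \<in> \<beta> \<Longrightarrow> v \<in> \<beta> \<Longrightarrow> prefix u v \<or> prefix v u"
    and branch_maximal:
      "w \<in> nodes T \<Longrightarrow> (\<And>v. v \<in> \<beta> \<Longrightarrow> prefix w v \<or> prefix v w) \<Longrightarrow> w \<in> \<beta>"
proof -
  interpret pred_on "nodes T" strict_prefix .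
  have max: "maxchain \<beta>" using assms by (simp add: branch_def)
  then have ch: "chain \<beta>" by (rule maxchain_imp_chain)
  show "u \<in> \<beta> \<Longrightarrow> u \<in> nodes T" using chain_def ch by blast
  show cmp: "prefix u v \<or> prefix v u" if "u \<in> \<beta>" "v \<in> \<beta>" for u v
    using ch that unfolding chain_def by (auto simp: strict_prefix_def)
  assume w: "w \<in> nodes T" "\<And>v. v \<in> \<beta> \<Longrightarrow> prefix w v \<or> prefix v w"
  have "chain (insert w \<beta>)"
    using ch w unfolding chain_def by (auto simp: strict_prefix_def)
  then show "w \<in> \<beta>" using max unfolding maxchain_def by blast
qed

lemma branch_Nil:
  assumes "branch T \<beta>" "is_tree T"
  shows "[] \<in> \<beta>"
  using assms by (auto intro: branch_maximal simp: is_tree_def)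

lemma branch_prefix:
  assumes "branch T \<beta>" "is_tree T" "v \<in> \<beta>" "prefix u v"
  shows "u \<in> \<beta>"
proof (rule branch_maximal[OF assms(1)])
  show "u \<in> nodes T" using assms branch_nodes unfolding is_tree_def by blast
  show "prefix u w \<or> prefix w u" if "w \<in> \<beta>" for w
    using branch_comparable[OF assms(1,3) that] assms(4)
    by (meson prefix_order.trans prefix_same_cases)
qed

lemma branch_child:
  assumes "branch T \<beta>" "is_tree T" "u \<in> \<beta>" "u @ [k] \<in> nodes T"
  obtains k' where "u @ [k'] \<in> \<beta>"
proof -
  have "\<exists>w\<in>\<beta>. \<not> prefix w u"
  proof (rule ccontr)
    assume below: "\<not> ?thesis"
    then have "u @ [k] \<in> \<beta>" using assms(4) by (intro branch_maximal[OF assms(1)]) auto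
    with below show False by auto
  qed
  then obtain w where w: "w \<in> \<beta>" "strict_prefix u w"
    using branch_comparable[OF assms(1,3)] by (auto simp: strict_prefix_def)
  then obtain k' zs where "w = u @ k' # zs" by (auto elim: strict_prefixE')
  then have "prefix (u @ [k']) w" by simp
  with branch_prefix[OF assms(1,2) w(1)] that show thesis by blast
qed

lemma branch_fms_eq:
  assumes "branch T \<beta>" "is_tree T"
  shows "branch_fms T \<beta> = (\<Union>u\<in>\<beta>. path_fms T u)"
  unfolding branch_fms_def path_fms_def using branch_prefix[OF assms] by auto

lemma branch_finite_subset:
  assumes "branch T \<beta>" "is_tree T" "finite P" "P \<subseteq> branch_fms T \<beta>"
  obtains u where "u \<in> \<beta>" "P \<subseteq> path_fms T u"
proof -
  have "\<exists>u\<in>\<beta>. P \<subseteq> path_fms T u" using assms(3,4)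
  proof (induction P rule: finite_induct)
    case empty
    then show ?case using branch_Nil[OF assms(1,2)] by blast
  next
    case (insert \<chi> P)
    then obtain u v where "u \<in> \<beta>" "P \<subseteq> path_fms T u" "v \<in> \<beta>" "\<chi> \<in> path_fms T v"
      unfolding branch_fms_eq[OF assms(1,2)] by auto
    then show ?case
      using branch_comparable[OF assms(1), of u v] path_fms_mono[of u v T] path_fms_mono[of v u T]
      by blast
  qed
  with that show thesis by blast
qed


section \<open>Fairness\<close>

lemma closed_fms_mono: "S \<subseteq> S' \<Longrightarrow> closed_fms S \<Longrightarrow> closed_fms S'"
  unfolding closed_fms_def by (meson subsetD)

text \<open>
  Once a task has been carried out, the branch contains one of its outcomes, or a diamond
  formula is marked as used. Neither is ever undone.
\<close>

lemma not_pending_after: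
  assumes child: "u @ [k] \<in> nodes (systematic \<rho>)" and t: "task_at (systematic \<rho>) u = Some t"
    and v: "prefix (u @ [k]) v"
  shows "\<not> pending_at (systematic \<rho>) v t"
proof -
  let ?T = "systematic \<rho>"
  let ?Cs = "outcomes (path_fms ?T u) t"
  have u: "u \<in> nodes ?T" and k: "k < length ?Cs" using child t unfolding systematic_snoc by auto
  have C: "?Cs ! k \<subseteq> path_fms ?T v" "?Cs ! k \<in> set ?Cs"
    using path_fms_mono[OF v, of ?T] systematic_label[OF child t] k by auto
  have U: "set_option (dia_of t) \<subseteq> used ?T v"
    using used_mono[OF v, of ?T] systematic_dia_at[OF u] t by auto
  show ?thesis
  proof (cases t)
    case (Inl z)
    with C show ?thesis by (cases z) auto
  next
    case (Inr \<chi>)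
    with U show ?thesis by simp
  qed
qed

text \<open>
  By induction on \<open>n\<close>: from a node on where the tasks with smaller codes have come to rest, the task
  with code \<open>n\<close> is the first in line whenever it is pending, so it is carried out at once and
  comes to rest as well.
\<close>

lemma fairness:
  fixes \<rho> :: "('p :: countable, 'n :: countable, 'm :: countable) fm"
  assumes \<beta>: "branch (systematic \<rho>) \<beta>" and op: "\<not> closed_branch (systematic \<rho>) \<beta>"
  shows "\<exists>u\<in>\<beta>. \<forall>v\<in>\<beta>. \<forall>t. prefix u v \<longrightarrow> pending_at (systematic \<rho>) v t \<longrightarrow> n \<le> code t"
proof (induction n)
  case 0
  show ?case using branch_Nil[OF \<beta> is_tree_systematic] by blast
next
  case (Suc n)
  let ?T = "systematic \<rho>"
  from Suc obtain u where u: "u \<in> \<beta>"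
    "\<And>v t. v \<in> \<beta> \<Longrightarrow> prefix u v \<Longrightarrow> pending_at ?T v t \<Longrightarrow> n \<le> code t" by blast
  show ?case
  proof (cases "\<exists>v\<in>\<beta>. prefix u v \<and> (\<exists>t. pending_at ?T v t \<and> code t = n)")
    case False
    have "Suc n \<le> code t" if "v \<in> \<beta>" "prefix u v" "pending_at ?T v t" for v t
      using u(2)[OF that] False that by (auto simp: Suc_le_eq order_less_le)
    with u(1) show ?thesis by blast
  next
    case True
    then obtain v t where v: "v \<in> \<beta>" "prefix u v" and t: "pending_at ?T v t" "code t = n" by blast
    have "path_fms ?T v \<subseteq> branch_fms ?T \<beta>"
      using v(1) unfolding branch_fms_eq[OF \<beta> is_tree_systematic] by blast
    then have "\<not> closed_fms (path_fms ?T v)"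
      using op closed_fms_mono unfolding closed_branch_def by blast
    with t(1) have "task_at ?T v = Some (arg_min code (pending_at ?T v))"
      unfolding next_task_def by auto
    then obtain t' where t': "task_at ?T v = Some t'" by blast
    note nt = next_task_SomeD[OF t']
    have "code t' = code t" using nt(3)[OF t(1)] u(2)[OF v nt(2)] t(2) by simp
    then have "t' = t" by (rule code_inj[OF nt(2) t(1)])
    with t' have first: "task_at ?T v = Some t" by simp
    have "v @ [0] \<in> nodes ?T"
      using systematic_snoc first branch_nodes[OF \<beta> v(1)] outcomes_nonempty[OF t(1)] by auto
    then obtain k where k: "v @ [k] \<in> \<beta>" by (rule branch_child[OF \<beta> is_tree_systematic v(1)])
    have "Suc n \<le> code s" if w: "w \<in> \<beta>" "prefix (v @ [k]) w" and s: "pending_at ?T w s" for w s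
    proof -
      have "prefix v w" using w(2) append_prefixD by blast
      then have uw: "prefix u w" using v(2) by (rule prefix_order.trans[rotated])
      have rest: "\<not> pending_at ?T w t"
        by (rule not_pending_after[OF branch_nodes[OF \<beta> k] first w(2)])
      have "code s \<noteq> n"
        using code_inj[OF s t(1)] t(2) s rest by auto
      with u(2)[OF w(1) uw s] show ?thesis by simp
    qed
    with k show ?thesis by blast
  qed
qed

lemma saturated_systematic:
  fixes \<rho> :: "('p :: countable, 'n :: countable, 'm :: countable) fm"
  assumes \<beta>: "branch (systematic \<rho>) \<beta>" and op: "\<not> closed_branch (systematic \<rho>) \<beta>"
  shows "saturated (systematic \<rho>) \<beta>"
proof -
  let ?T = "systematic \<rho>"
  note tree = is_tree_systematic[of \<rho>]
  have settle: "\<exists>w\<in>\<beta>. P \<subseteq> path_fms ?T w \<and> \<not> pending_at ?T w t"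
    if P: "finite P" "P \<subseteq> branch_fms ?T \<beta>" for P t
  proof -
    obtain u where u: "u \<in> \<beta>" "P \<subseteq> path_fms ?T u" using branch_finite_subset[OF \<beta> tree P] .
    obtain v where v: "v \<in> \<beta>"
      "\<And>w s. w \<in> \<beta> \<Longrightarrow> prefix v w \<Longrightarrow> pending_at ?T w s \<Longrightarrow> Suc (code t) \<le> code s"
      using fairness[OF \<beta> op, of "Suc (code t)"] by blast
    from branch_comparable[OF \<beta> u(1) v(1)] show ?thesis
    proof
      assume "prefix u v"
      then have "P \<subseteq> path_fms ?T v" using u(2) path_fms_mono[of u v ?T] by blast
      moreover have "\<not> pending_at ?T v t" using v(2)[OF v(1), of t] by auto
      ultimately show ?thesis using v(1) by blast
    next
      assume "prefix v u"
      then show ?thesis using u v(2)[of u t] by auto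
    qed
  qed
  show ?thesis unfolding saturated_def
  proof (intro conjI allI impI ballI)
    fix P Cs assume P: "rule P Cs \<and> P \<subseteq> branch_fms ?T \<beta>"
    with settle[of P "Inl (P, Cs)"] rule_finite(1)
    obtain w where "w \<in> \<beta>" "\<exists>C\<in>set Cs. C \<subseteq> path_fms ?T w" by auto
    then show "\<exists>C\<in>set Cs. C \<subseteq> branch_fms ?T \<beta>" unfolding branch_fms_eq[OF \<beta> tree] by blast
  next
    fix \<chi> assume \<chi>: "\<chi> \<in> branch_fms ?T \<beta> \<inter> dia_premises"
    with settle[of "{\<chi>}" "Inr \<chi>"] obtain w where "w \<in> \<beta>" "\<chi> \<in> used ?T w" by auto
    then show "\<exists>u\<in>\<beta>. dia_at ?T u = Some \<chi>"
      using branch_prefix[OF \<beta> tree] unfolding used_def strict_prefix_def by blast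
  qed
qed

lemma tableau_systematic:
  fixes \<rho> :: "('p :: countable, 'n :: {countable, infinite}, 'm :: {countable, infinite}) fm"
  shows "tableau \<rho> (systematic \<rho>)"
  unfolding tableau_def
  using is_tree_systematic systematic_Nil node_systematic saturated_systematic by blast


section \<open>Completeness\<close>

text \<open>
  Saturation only says that a diamond rule has been applied at some node of the branch; that
  its outcome lies on the branch as well uses that the node has a single child.
\<close>

lemma branch_dia_outcome:
  assumes T: "tableau \<rho> T" and \<beta>: "branch T \<beta>" and u: "u \<in> \<beta>" and d: "dia_at T u = Some \<chi>"
  obtains C where "dia_rule (path_fms T u) \<chi> C" "C \<subseteq> branch_fms T \<beta>"
proof -
  have tree: "is_tree T" using T by (simp add: tableau_def)
  have "u \<in> nodes T" using branch_nodes[OF \<beta> u] .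
  with T d have "dia_node T u"
    unfolding tableau_def leaf_node_def rule_node_def by auto
  with d obtain C where C: "dia_rule (path_fms T u) \<chi> C" "has_children T u [C]"
    unfolding dia_node_def by auto
  then have ch: "u @ [k] \<in> nodes T \<longleftrightarrow> k = 0" and lab: "label T (u @ [0]) = C" for k
    unfolding has_children_def by auto
  from ch[of 0] obtain k where "u @ [k] \<in> \<beta>" using branch_child[OF \<beta> tree u] by blast
  with ch branch_nodes[OF \<beta>] have "u @ [0] \<in> \<beta>" by metis
  with lab have "C \<subseteq> branch_fms T \<beta>" unfolding branch_fms_def by blast
  with C that show thesis by blast
qed

lemma saturated_open_branch:
  fixes T :: "('p :: countable, 'n :: countable, 'm :: countable) tree"
  assumes T: "tableau \<rho> T" and \<beta>: "branch T \<beta>" and op: "\<not> closed_branch T \<beta>"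
  shows "saturated_open (branch_fms T \<beta>)"
proof
  have sat: "saturated T \<beta>" using assms unfolding tableau_def by blast
  show "\<exists>C\<in>set Cs. C \<subseteq> branch_fms T \<beta>" if "rule P Cs" "P \<subseteq> branch_fms T \<beta>" for P Cs
    using sat that unfolding saturated_def by blast
  show "\<not> closed_fms (branch_fms T \<beta>)" using op by (simp add: closed_branch_def)
  have dia: "\<exists>S C. dia_rule S \<chi> C \<and> C \<subseteq> branch_fms T \<beta>"
    if "\<chi> \<in> branch_fms T \<beta>" "\<chi> \<in> dia_premises" for \<chi>
    using sat that branch_dia_outcome[OF T \<beta>] unfolding saturated_def by (metis IntI)
  show "\<exists>j. At1 i (Dia1 (nm1 j)) \<in> branch_fms T \<beta> \<and> at12 j a \<phi> \<in> branch_fms T \<beta>"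
    if "at12 i a (Dia1 \<phi>) \<in> branch_fms T \<beta>" for i a \<phi>
    using dia[OF that] by (auto simp: dia_premises_def elim!: dia_rule.cases)
  show "\<exists>b. At2 a (Dia2 (nm2 b)) \<in> branch_fms T \<beta> \<and> at12 i b \<phi> \<in> branch_fms T \<beta>"
    if "at12 i a (Dia2 \<phi>) \<in> branch_fms T \<beta>" for i a \<phi>
    using dia[OF that] by (auto simp: dia_premises_def elim!: dia_rule.cases)
qed

theorem theorem5p14:
  fixes \<phi> :: "('p :: countable, 'n :: {countable, infinite}, 'm :: {countable, infinite}) fm"
  assumes "valid \<phi>"
  shows "provable \<phi>"
proof -
  obtain i a where fresh: "i \<notin> nom1s \<phi>" "a \<notin> nom2s \<phi>"
    using ex_new_if_finite[OF infinite_UNIV finite_noms(1)]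
      ex_new_if_finite[OF infinite_UNIV finite_noms(2)] by meson
  define \<rho> where "\<rho> = at12 i a (Neg \<phi>)"
  have T: "tableau \<rho> (systematic \<rho>)" by (rule tableau_systematic)
  have "closed_branch (systematic \<rho>) \<beta>" if \<beta>: "branch (systematic \<rho>) \<beta>" for \<beta>
  proof (rule ccontr)
    assume "\<not> closed_branch (systematic \<rho>) \<beta>"
    then interpret saturated_open "branch_fms (systematic \<rho>) \<beta>"
      by (rule saturated_open_branch[OF T \<beta>])
    have "\<rho> \<in> branch_fms (systematic \<rho>) \<beta>"
      unfolding branch_fms_def using branch_Nil[OF \<beta> is_tree_systematic] systematic_Nil(2) by force
    then have "\<not> valid \<phi>" using refutes[of i a \<phi>] by (simp add: \<rho>_def)
    with assms show False by blast
  qed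
  then have "closed_tableau (systematic \<rho>)" unfolding closed_tableau_def by blast
  with T fresh show ?thesis unfolding provable_def \<rho>_def by blast
qed

end
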